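(* Let $n\ge 3$. There is no $C^\infty$-special Frenet curve in $\mathbb{E}_\nu^{n+1}$ which is a Bertrand curve.
   Context: $\mathbb{E}_\nu^{n+1}$ ($0\le\nu\le n+1$) is $\mathbb{R}^{n+1}$ with the flat metric $g=-\sum_{i=1}^{\nu}dx_i^2+\sum_{i=\nu+1}^{n+1}dx_i^2$. A $C^\infty$-special Frenet curve $C$ in $\mathbb{E}_\nu^{n+1}$ is a $C^\infty$ curve $\mathbf c:L\to\mathbb{E}_\nu^{n+1}$ ($L$ an interval), parametrized by arc length $s$ (i.e. $g(\mathbf c',\mathbf c')$ is constantly $1$ or constantly $-1$), with a $C^\infty$ frame $\{\mathbf n_0=\mathbf t=\mathbf c',\mathbf n_1,\dots,\mathbf n_n\}$ of mutually orthogonal vector fields along $C$ with $g(\mathbf n_i,\mathbf n_i)=\varepsilon_i\in\{1,-1\}$, and nowhere-zero $C^\infty$ functions $k_1,\dots,k_n$ on $L$ (the curvatures) such that the Frenet formulas hold: $$\mathbf n_0'=\varepsilon_1k_1\mathbf n_1,\qquad \mathbf n_i'=-\varepsilon_{i-1}k_i\mathbf n_{i-1}+\varepsilon_{i+1}k_{i+1}\mathbf n_{i+1}\ (1\le i\le n-1),\qquad \mathbf n_n'=-\varepsilon_{n-1}k_n\mathbf n_{n-1}.$$ A $C^\infty$-special Frenet curve $C$ ($\mathbf c:L\to\mathbb{E}_\nu^{n+1}$) is called a Bertrand curve if there exist another $C^\infty$-special Frenet curve $\bar C$ ($\bar{\mathbf c}:\bar L\to\mathbb{E}_\nu^{n+1}$),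 distinct from $C$, and a regular $C^\infty$ map $\varphi:L\to\bar L$, $\bar s=\varphi(s)$, with $\frac{d\varphi}{ds}(s)\ne0$ for all $s\in L$, such that the two curves have the same 1-normal line at each pair of corresponding points $\mathbf c(s)$ and $\bar{\mathbf c}(\varphi(s))$. Here $s,\bar s$ are arc length parameters, and the 1-normal line of $C$ at $\mathbf c(s)$ is the affine line through $\mathbf c(s)$ in the direction $\mathbf n_1(s)$ (similarly for $\bar C$ with $\bar{\mathbf n}_1$). "Distinct from $C$" means that it is not the case that $\bar{\mathbf c}(\varphi(s))=\mathbf c(s)$ for all $s\in L$. *)

theory Defs
  imports "HOL-Analysis.Analysis"
begin

text \<open>
  The coordinates of \<open>real ^ 'd\<close> are indexed by an unordered finite type. A bijection \<open>e\<close> from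
  \<open>{1..n+1}\<close> onto that type labels them, so that \<open>x $ e i\<close> is the coordinate \<open>x\<^sub>i\<close>.
\<close>

definition pseudo_metric ::
    "(nat \<Rightarrow> 'd::finite) \<Rightarrow> nat \<Rightarrow> nat \<Rightarrow> real ^ 'd \<Rightarrow> real ^ 'd \<Rightarrow> real" where
  "pseudo_metric e n \<nu> x y =
     - (\<Sum>i = 1..\<nu>. x $ e i * y $ e i) + (\<Sum>i = \<nu> + 1..n + 1. x $ e i * y $ e i)"

text \<open>
  \<open>F k\<close> is the \<open>k\<close>-th derivative of \<open>f\<close>; derivatives are one-sided at end points belonging to \<open>L\<close>.
  This is meant for sets without isolated points, such as nondegenerate intervals, where
  derivatives within \<open>L\<close> are unique.
\<close>

definition smooth_on :: "real set \<Rightarrow> (real \<Rightarrow> 'a::real_normed_vector) \<Rightarrow> bool" where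
  "smooth_on L f \<longleftrightarrow>
     (\<exists>F :: nat \<Rightarrow> real \<Rightarrow> 'a. F 0 = f \<and>
        (\<forall>k. \<forall>t\<in>L. (F k has_vector_derivative F (Suc k) t) (at t within L)))"

text \<open>
  The values of \<open>pos\<close>, \<open>frame i\<close> and \<open>curv i\<close> are relevant on \<open>param_dom\<close> only; \<open>frame i\<close> and
  \<open>eps i\<close> matter for \<open>i \<le> n\<close>, and \<open>curv i\<close> for \<open>1 \<le> i \<le> n\<close>.
\<close>

record 'd framed_curve =
  param_dom :: "real set"
  pos :: "real \<Rightarrow> real ^ 'd"
  frame :: "nat \<Rightarrow> real \<Rightarrow> real ^ 'd"
  eps :: "nat \<Rightarrow> real"
  curv :: "nat \<Rightarrow> real \<Rightarrow> real"

text \<open>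
  Parametrization by arc length is the case \<open>i = 0\<close> of the normalization of the frame, since
  \<open>frame C 0\<close> is the velocity of the curve.
\<close>

definition special_Frenet_curve ::
    "(nat \<Rightarrow> 'd::finite) \<Rightarrow> nat \<Rightarrow> nat \<Rightarrow> 'd framed_curve \<Rightarrow> bool" where
  "special_Frenet_curve e n \<nu> C \<longleftrightarrow>
     is_interval (param_dom C) \<and> interior (param_dom C) \<noteq> {} \<and>
     smooth_on (param_dom C) (pos C) \<and>
     (\<forall>i\<le>n. smooth_on (param_dom C) (frame C i)) \<and>
     (\<forall>i\<in>{1..n}. smooth_on (param_dom C) (curv C i) \<and> (\<forall>s\<in>param_dom C. curv C i s \<noteq> 0)) \<and>
     (\<forall>i\<le>n. eps C i \<in> {1, -1}) \<and>
     (\<forall>s\<in>param_dom C.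
        (\<forall>i\<le>n. pseudo_metric e n \<nu> (frame C i s) (frame C i s) = eps C i) \<and>
        (\<forall>i\<le>n. \<forall>j\<le>n. i \<noteq> j \<longrightarrow> pseudo_metric e n \<nu> (frame C i s) (frame C j s) = 0) \<and>
        (pos C has_vector_derivative frame C 0 s) (at s within param_dom C) \<and>
        (frame C 0 has_vector_derivative (eps C 1 * curv C 1 s) *\<^sub>R frame C 1 s)
          (at s within param_dom C) \<and>
        (\<forall>i\<in>{1..n - 1}.
           (frame C i has_vector_derivative
              - (eps C (i - 1) * curv C i s) *\<^sub>R frame C (i - 1) s
              + (eps C (i + 1) * curv C (i + 1) s) *\<^sub>R frame C (i + 1) s)
             (at s within param_dom C)) \<and>
        (frame C n has_vector_derivative - (eps C (n - 1) * curv C n s) *\<^sub>R frame C (n - 1) s)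
          (at s within param_dom C))"

definition normal_line_1 :: "'d::finite framed_curve \<Rightarrow> real \<Rightarrow> (real ^ 'd) set" where
  "normal_line_1 C s = range (\<lambda>r. pos C s + r *\<^sub>R frame C 1 s)"

definition Bertrand_curve ::
    "(nat \<Rightarrow> 'd::finite) \<Rightarrow> nat \<Rightarrow> nat \<Rightarrow> 'd framed_curve \<Rightarrow> bool" where
  "Bertrand_curve e n \<nu> C \<longleftrightarrow>
     special_Frenet_curve e n \<nu> C \<and>
     (\<exists>C' \<phi>. special_Frenet_curve e n \<nu> C' \<and>
        \<phi> ` param_dom C \<subseteq> param_dom C' \<and>
        smooth_on (param_dom C) \<phi> \<and>
        (\<forall>s\<in>param_dom C. \<exists>d. d \<noteq> 0 \<and> (\<phi> has_real_derivative d) (at s within param_dom C)) \<and>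
        \<not> (\<forall>s\<in>param_dom C. pos C' (\<phi> s) = pos C s) \<and>
        (\<forall>s\<in>param_dom C. normal_line_1 C s = normal_line_1 C' (\<phi> s)))"

end

(*
  The curve C' at corresponding points is c + a n_1. Differentiating g(c' o phi - c, n_1) shows that
  a is constant, nonzero because the curves are distinct. Hence phi' t' = t + a n_1' lies in the span
  of t and n_2, with nonzero n_2-component. Now g(t' o phi, n_3) vanishes identically; as t' has
  derivative parallel to n_1, differentiation leaves g(t', n_3') = 0, and there only the n_2-component
  of n_3' contributes, giving a k_2 k_3 = 0.
*)
theory Submission
  imports Defs
begin

text \<open>Supplies the product rule for the possibly indefinite form; boundedness comes for free
  in finite dimension.\<close>

lemma bounded_bilinear_pseudo_metric: "bounded_bilinear (pseudo_metric e n \<nu>)"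
proof -
  have "bilinear (pseudo_metric e n \<nu>)"
    unfolding bilinear_def pseudo_metric_def
    by (auto intro!: linearI simp: algebra_simps sum.distrib sum_distrib_left)
  then show ?thesis
    by (simp add: bilinear_conv_bounded_bilinear)
qed

text \<open>This makes derivatives within \<open>L\<close> unique, end points included: a connected
  set that is not a singleton has no isolated points.\<close>

lemma at_within_interval_neq_bot:
  fixes L :: "real set"
  assumes "is_interval L" and "interior L \<noteq> {}" and "s \<in> L"
  shows "at s within L \<noteq> bot"
proof -
  have "\<nexists>a. L = {a}"
    using assms(2) by auto
  then have "s islimpt L"
    using assms(1,3) by (simp add: connected_imp_perfect is_interval_connected)
  then show ?thesis
    by (simp add: trivial_limit_within)
qed

lemma has_vector_derivative_reparam:
  fixes f :: "real \<Rightarrow> 'a::real_normed_vector"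
  assumes "(\<phi> has_real_derivative d) (at s within L)"
    and "(f has_vector_derivative v) (at (\<phi> s) within L')"
    and "\<phi> ` L \<subseteq> L'"
  shows "((\<lambda>s. f (\<phi> s)) has_vector_derivative d *\<^sub>R v) (at s within L)"
proof -
  have "(f has_vector_derivative v) (at (\<phi> s) within \<phi> ` L)"
    using assms(2,3) has_vector_derivative_within_subset by blast
  with assms(1) show ?thesis
    using vector_diff_chain_within[of \<phi> d s L f v]
    by (simp add: has_real_derivative_iff_has_vector_derivative o_def)
qed

text \<open>The points of the first line with parameters 0 and 1 both lie on the second line, and
  their difference is \<open>u\<close>.\<close>

lemma line_direction_parallel:
  fixes p q u v :: "'a::real_vector"
  assumes "range (\<lambda>r. p + r *\<^sub>R u) = range (\<lambda>r. q + r *\<^sub>R v)"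
  shows "\<exists>m. u = m *\<^sub>R v"
proof -
  have "p + 0 *\<^sub>R u \<in> range (\<lambda>r. q + r *\<^sub>R v)" "p + 1 *\<^sub>R u \<in> range (\<lambda>r. q + r *\<^sub>R v)"
    using assms by blast+
  then obtain a b where "p + 0 *\<^sub>R u = q + a *\<^sub>R v" "p + 1 *\<^sub>R u = q + b *\<^sub>R v"
    by (elim imageE)
  then have "u = (b - a) *\<^sub>R v"
    by (simp add: algebra_simps)
  then show ?thesis ..
qed

lemma special_Frenet_curveD:
  assumes "special_Frenet_curve e n \<nu> C"
  shows "is_interval (param_dom C)" and "interior (param_dom C) \<noteq> {}"
    and "i \<le> n \<Longrightarrow> eps C i \<in> {1, -1}"
    and "i \<in> {1..n} \<Longrightarrow> s \<in> param_dom C \<Longrightarrow> curv C i s \<noteq> 0"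
    and "s \<in> param_dom C \<Longrightarrow> i \<le> n \<Longrightarrow> pseudo_metric e n \<nu> (frame C i s) (frame C i s) = eps C i"
    and "s \<in> param_dom C \<Longrightarrow> i \<le> n \<Longrightarrow> j \<le> n \<Longrightarrow> i \<noteq> j \<Longrightarrow>
      pseudo_metric e n \<nu> (frame C i s) (frame C j s) = 0"
    and "s \<in> param_dom C \<Longrightarrow>
      (pos C has_vector_derivative frame C 0 s) (at s within param_dom C)"
    and "s \<in> param_dom C \<Longrightarrow>
      (frame C 0 has_vector_derivative (eps C 1 * curv C 1 s) *\<^sub>R frame C 1 s)
        (at s within param_dom C)"
    and "s \<in> param_dom C \<Longrightarrow> i \<in> {1..n - 1} \<Longrightarrow>
      (frame C i has_vector_derivative
         - (eps C (i - 1) * curv C i s) *\<^sub>R frame C (i - 1) s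
         + (eps C (i + 1) * curv C (i + 1) s) *\<^sub>R frame C (i + 1) s) (at s within param_dom C)"
    and "s \<in> param_dom C \<Longrightarrow>
      (frame C n has_vector_derivative - (eps C (n - 1) * curv C n s) *\<^sub>R frame C (n - 1) s)
        (at s within param_dom C)"
  using assms unfolding special_Frenet_curve_def by simp_all

lemma special_Frenet_curve_not_Bertrand:
  assumes n: "n \<ge> 3" and C: "special_Frenet_curve e n \<nu> C"
  shows "\<not> Bertrand_curve e n \<nu> C"
proof
  assume "Bertrand_curve e n \<nu> C"
  then obtain C' \<phi> where C': "special_Frenet_curve e n \<nu> C'"
    and img: "\<phi> ` param_dom C \<subseteq> param_dom C'"
    and "\<forall>s\<in>param_dom C. \<exists>d. d \<noteq> 0 \<and> (\<phi> has_real_derivative d) (at s within param_dom C)"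
    and distinct: "\<not> (\<forall>s\<in>param_dom C. pos C' (\<phi> s) = pos C s)"
    and lines: "\<And>s. s \<in> param_dom C \<Longrightarrow> normal_line_1 C s = normal_line_1 C' (\<phi> s)"
    unfolding Bertrand_curve_def by blast
  then obtain d where d: "\<And>s. s \<in> param_dom C \<Longrightarrow> d s \<noteq> 0"
      "\<And>s. s \<in> param_dom C \<Longrightarrow> (\<phi> has_real_derivative d s) (at s within param_dom C)"
    by metis
  define L where "L = param_dom C"
  define g where "g = pseudo_metric e n \<nu>"
  define N where "N = frame C"
  define T' where "T' s = frame C' 0 (\<phi> s)" for s
  define \<Delta> where "\<Delta> s = pos C' (\<phi> s) - pos C s" for s
  interpret g: bounded_bilinear g
    unfolding g_def by (rule bounded_bilinear_pseudo_metric)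
  note g_bilinear = g.add_left g.add_right g.scaleR_left g.scaleR_right
    g.diff_left g.diff_right g.minus_left g.minus_right g.zero_left g.zero_right
  note F = special_Frenet_curveD[OF C, folded L_def g_def N_def]
  note F' = special_Frenet_curveD[OF C', folded g_def]
  \<comment> \<open>The index \<open>1\<close> must not become \<open>Suc 0\<close>, or equations
    about \<open>N 1\<close> would no longer match.\<close>
  note One_nat_def [simp del]
  have img': "\<phi> s \<in> param_dom C'" if "s \<in> L" for s
    using img that L_def by blast

  have reparam: "((\<lambda>s. f (\<phi> s)) has_vector_derivative d s *\<^sub>R v) (at s within L)"
    if "s \<in> L" "(f has_vector_derivative v) (at (\<phi> s) within param_dom C')" for f v s
    using has_vector_derivative_reparam[OF d(2) that(2) img] that(1) by (simp add: L_def)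

  \<comment> \<open>Proportionality is needed in both directions. The factors \<open>m\<close> and
    \<open>m'\<close> are chosen pointwise and never differentiated.\<close>
  have "\<exists>m. N 1 s = m *\<^sub>R frame C' 1 (\<phi> s)" "\<exists>m. frame C' 1 (\<phi> s) = m *\<^sub>R N 1 s"
    if "s \<in> L" for s
    using lines that line_direction_parallel unfolding normal_line_1_def N_def L_def by metis+
  then obtain m m' where m: "\<And>s. s \<in> L \<Longrightarrow> N 1 s = m s *\<^sub>R frame C' 1 (\<phi> s)"
    and m': "\<And>s. s \<in> L \<Longrightarrow> frame C' 1 (\<phi> s) = m' s *\<^sub>R N 1 s"
    by metis

  have \<Delta>_parallel: "\<exists>a. \<Delta> s = a *\<^sub>R N 1 s" if "s \<in> L" for s
  proof -
    have "pos C' (\<phi> s) + 0 *\<^sub>R frame C' 1 (\<phi> s) \<in> normal_line_1 C s"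
      using lines that unfolding normal_line_1_def L_def by blast
    then show ?thesis
      unfolding normal_line_1_def \<Delta>_def N_def by auto
  qed
  have \<Delta>_deriv: "(\<Delta> has_vector_derivative d s *\<^sub>R T' s - N 0 s) (at s within L)" if "s \<in> L" for s
    unfolding \<Delta>_def T'_def
    by (intro has_vector_derivative_diff reparam F'(7) F(7) img' that)
  have N1_deriv: "(N 1 has_vector_derivative
      - (eps C 0 * curv C 1 s) *\<^sub>R N 0 s + (eps C 2 * curv C 2 s) *\<^sub>R N 2 s) (at s within L)"
    if "s \<in> L" for s
    using F(9)[of s 1] that n by simp
  have T'_N1: "g (T' s) (N 1 s) = 0" if "s \<in> L" for s
    using F'(6)[of "\<phi> s" 0 1] that n by (simp add: m T'_def img' g_bilinear)

  \<comment> \<open>Both terms of the product rule vanish: \<open>T' s\<close> and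
    \<open>N 0 s\<close> are orthogonal to \<open>N 1 s\<close>, and so is the derivative of
    \<open>N 1\<close>, while \<open>\<Delta> s\<close> is a multiple of
    \<open>N 1 s\<close>.\<close>
  have "((\<lambda>s. g (\<Delta> s) (N 1 s)) has_vector_derivative 0) (at s within L)" if s: "s \<in> L" for s
  proof -
    obtain a where "\<Delta> s = a *\<^sub>R N 1 s"
      using \<Delta>_parallel[OF s] by blast
    then show ?thesis
      using g.has_vector_derivative[OF \<Delta>_deriv[OF that] N1_deriv[OF that]] that n
      by (simp add: g_bilinear T'_N1 F(6))
  qed
  then have "\<exists>\<beta>. \<forall>s\<in>L. g (\<Delta> s) (N 1 s) = \<beta>"
    by (rule has_vector_derivative_zero_constant[OF is_interval_convex[OF F(1)]]) auto
  then obtain \<beta> where \<beta>: "\<forall>s\<in>L. g (\<Delta> s) (N 1 s) = \<beta>"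
    by blast
  \<comment> \<open>Since \<open>g (N 1 s) (N 1 s) = eps C 1\<close>, this is the only possible
    coefficient of \<open>\<Delta> s\<close> along \<open>N 1 s\<close>.\<close>
  define \<alpha> where "\<alpha> = \<beta> / eps C 1"
  have eps1: "eps C 1 \<noteq> 0" and eps2: "eps C 2 \<noteq> 0"
    using F(3)[of 1] F(3)[of 2] n by auto
  have \<Delta>_eq: "\<Delta> s = \<alpha> *\<^sub>R N 1 s" if s: "s \<in> L" for s
  proof -
    obtain a where a: "\<Delta> s = a *\<^sub>R N 1 s"
      using \<Delta>_parallel[OF s] by blast
    then have "\<beta> = a * eps C 1"
      using bspec[OF \<beta> s] F(5)[of s 1] that n by (simp add: g_bilinear)
    then show ?thesis
      using a eps1 by (simp add: \<alpha>_def)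
  qed
  \<comment> \<open>Distinctness gives only one point with nonzero \<open>\<Delta>\<close>; this
    suffices because \<alpha> is constant.\<close>
  have "\<alpha> \<noteq> 0"
    using distinct \<Delta>_eq unfolding \<Delta>_def L_def by auto

  \<comment> \<open>Two derivatives of the same function are compared: that of
    \<open>\<Delta>\<close> as a difference of positions and that of
    \<open>\<alpha> *\<^sub>R N 1 s\<close>.\<close>
  have T'_eq: "d s *\<^sub>R T' s = N 0 s +
      \<alpha> *\<^sub>R (- (eps C 0 * curv C 1 s) *\<^sub>R N 0 s + (eps C 2 * curv C 2 s) *\<^sub>R N 2 s)"
    if "s \<in> L" for s
  proof -
    have "((\<lambda>s. \<alpha> *\<^sub>R N 1 s) has_vector_derivative d s *\<^sub>R T' s - N 0 s) (at s within L)"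
      by (rule has_vector_derivative_transform[OF that _ \<Delta>_deriv[OF that]]) (simp add: \<Delta>_eq)
    moreover have "((\<lambda>s. \<alpha> *\<^sub>R N 1 s) has_vector_derivative
        \<alpha> *\<^sub>R (- (eps C 0 * curv C 1 s) *\<^sub>R N 0 s + (eps C 2 * curv C 2 s) *\<^sub>R N 2 s)) (at s within L)"
      by (intro bounded_linear.has_vector_derivative[OF bounded_linear_scaleR_right] N1_deriv that)
    ultimately show ?thesis
      using vector_derivative_unique_within[OF at_within_interval_neq_bot[OF F(1,2) that]]
      by (metis add.commute diff_add_cancel)
  qed
  have T'_orth: "g (T' s) v = 0" if "s \<in> L" "g (N 0 s) v = 0" "g (N 2 s) v = 0" for s v
  proof -
    have "d s * g (T' s) v = 0"
      using arg_cong[OF T'_eq[OF that(1)], of "\<lambda>x. g x v"] that by (simp add: g_bilinear)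
    then show ?thesis
      using d(1) that(1) L_def by simp
  qed
  \<comment> \<open>Pairing \<open>T'_eq\<close> with \<open>N 2 s\<close> removes the
    \<open>N 0 s\<close> terms and leaves a product of nonzero factors.\<close>
  have T'_N2: "g (T' s) (N 2 s) \<noteq> 0" if "s \<in> L" for s
  proof -
    have "d s * g (T' s) (N 2 s) = \<alpha> * (eps C 2 * curv C 2 s * eps C 2)"
      using arg_cong[OF T'_eq[OF that], of "\<lambda>x. g x (N 2 s)"] that n
      by (simp add: g_bilinear F(5,6))
    moreover have "curv C 2 s \<noteq> 0"
      using F(4) that n by simp
    ultimately show ?thesis
      using \<open>\<alpha> \<noteq> 0\<close> eps2 by auto
  qed

  obtain s where s: "s \<in> L"
    using F(2) interior_subset by fastforce
  \<comment> \<open>The remainder \<open>v\<close> unites two cases: it is 0 if the frame ends at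
    index 3, and the \<open>N 4 s\<close> term otherwise.\<close>
  obtain v where N3_deriv: "(N 3 has_vector_derivative - (eps C 2 * curv C 3 s) *\<^sub>R N 2 s + v)
      (at s within L)" and v: "g (N 0 s) v = 0" "g (N 2 s) v = 0"
  proof (cases "n = 3")
    case True
    then show thesis
      using F(10)[OF s] that[of 0] by (simp add: g_bilinear)
  next
    case False
    then show thesis
      using F(9)[OF s, of 3] n that[of "(eps C 4 * curv C 4 s) *\<^sub>R N 4 s"]
      by (simp add: g_bilinear F(6) s)
  qed
  have T'_deriv: "(T' has_vector_derivative
      d s *\<^sub>R (eps C' 1 * curv C' 1 (\<phi> s)) *\<^sub>R frame C' 1 (\<phi> s)) (at s within L)"
    unfolding T'_def
    by (intro reparam F'(8) img' s)
  \<comment> \<open>The derivative of \<open>T'\<close> is a multiple of \<open>N 1 s\<close> by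
    \<open>m'\<close>, hence orthogonal to \<open>N 3 s\<close>; \<open>T'_orth\<close> removes
    \<open>v\<close>, so only the \<open>N 2 s\<close> term survives.\<close>
  have "((\<lambda>s. g (T' s) (N 3 s)) has_vector_derivative - (eps C 2 * curv C 3 s) * g (T' s) (N 2 s))
      (at s within L)"
    using g.has_vector_derivative[OF T'_deriv N3_deriv] s n
    by (simp add: g_bilinear m' F(6) T'_orth v)
  \<comment> \<open>The same function vanishes on all of \<open>L\<close>, as \<open>N 3\<close> is
    orthogonal to \<open>N 0\<close> and \<open>N 2\<close>.\<close>
  moreover have "((\<lambda>s. g (T' s) (N 3 s)) has_vector_derivative 0) (at s within L)"
  proof (rule has_vector_derivative_transform[OF s _ has_vector_derivative_const])
    show "g (T' t) (N 3 t) = 0" if "t \<in> L" for t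
      using that n by (intro T'_orth) (auto intro!: F(6))
  qed
  ultimately have "- (eps C 2 * curv C 3 s) * g (T' s) (N 2 s) = 0"
    using vector_derivative_unique_within[OF at_within_interval_neq_bot[OF F(1,2) s]] by blast
  then show False
    using eps2 T'_N2[OF s] F(4)[of 3 s] s n by simp
qed

theorem mainTheorem2:
  fixes n \<nu> :: nat and e :: "nat \<Rightarrow> 'd::finite"
  assumes "n \<ge> 3" and "\<nu> \<le> n + 1"
    and "bij_betw e {1..n + 1} (UNIV :: 'd set)"
  shows "\<not> (\<exists>C :: 'd framed_curve. special_Frenet_curve e n \<nu> C \<and> Bertrand_curve e n \<nu> C)"
  using special_Frenet_curve_not_Bertrand[OF assms(1)] by blast

end
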